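(* Let $n>2$ be an integer, let $G=\mathrm{Dc}_n$, let $\varphi=\varphi_{(r,s)}\in\mathrm{Aut}(G)$ with $r\in\mathcal{U}_{2n}$ and $s\in\mathbb{Z}_{2n}$, and let $k\geq 1$ be an integer. Then $\varphi^k=\mathrm{id}$ if and only if $r^k\equiv 1 \pmod{2n}$ and $s(1+r+r^2+\cdots+r^{k-1})\equiv 0\pmod{2n}$.
   Context: $\mathrm{Dc}_n=\langle x,y \mid x^{2n}=1,\ y^2=x^n,\ y^{-1}xy=x^{-1}\rangle$ is the dicyclic group of order $4n$. $\mathcal{U}_{2n}$ denotes the set of units of $\mathbb{Z}_{2n}$ (integers modulo $2n$). For $n>2$, every automorphism of $\mathrm{Dc}_n$ can be written uniquely as $\varphi_{(r,s)}$ with $r\in\mathcal{U}_{2n}$, $s\in\mathbb{Z}_{2n}$, where $\varphi_{(r,s)}(x)=x^r$ and $\varphi_{(r,s)}(y)=yx^s$. *)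

theory Defs
  imports "HOL-Algebra.Bij" "HOL-Number_Theory.Residues"
begin

text \<open>A letter \<open>(a, False)\<close> stands for the generator \<open>a\<close>, and \<open>(a, True)\<close> for its formal inverse.\<close>

type_synonym 'a word = "('a \<times> bool) list"

text \<open>The congruence on words generated by free cancellation and by the relations \<open>l = r\<close>
  for \<open>(l, r) \<in> R\<close>. The generating set is the whole type \<open>'a\<close>.\<close>

inductive_set word_cong :: "('a word \<times> 'a word) set \<Rightarrow> ('a word \<times> 'a word) set"
  for R :: "('a word \<times> 'a word) set"
where
  cancel: "(u @ [(a, b), (a, \<not> b)] @ v, u @ v) \<in> word_cong R"
| relation: "(l, r) \<in> R \<Longrightarrow> (u @ l @ v, u @ r @ v) \<in> word_cong R"
| refl: "(w, w) \<in> word_cong R"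
| sym: "(w, w') \<in> word_cong R \<Longrightarrow> (w', w) \<in> word_cong R"
| trans: "(w, w') \<in> word_cong R \<Longrightarrow> (w', w'') \<in> word_cong R \<Longrightarrow> (w, w'') \<in> word_cong R"

definition presented_group :: "('a word \<times> 'a word) set \<Rightarrow> 'a word set monoid" where
  "presented_group R =
    \<lparr>carrier = UNIV // word_cong R,
     monoid.mult = \<lambda>A B. \<Union>u\<in>A. \<Union>v\<in>B. word_cong R `` {u @ v},
     one = word_cong R `` {[]}\<rparr>"

lemma equiv_word_cong: "equiv UNIV (word_cong R)"
proof (rule equivI)
  show "word_cong R \<subseteq> UNIV \<times> UNIV" by simp
  show "refl (word_cong R)" by (rule refl_onI) (rule word_cong.refl)
  show "sym (word_cong R)" by (rule symI) (rule word_cong.sym)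
  show "trans (word_cong R)" by (rule transI) (rule word_cong.trans)
qed

lemma word_cong_context:
  "(w, w') \<in> word_cong R \<Longrightarrow> (u @ w @ v, u @ w' @ v) \<in> word_cong R"
proof (induction rule: word_cong.induct)
  case (cancel u' a b v')
  then show ?case using word_cong.cancel[of "u @ u'" a b "v' @ v" R] by simp
next
  case (relation l r u' v')
  then show ?case using word_cong.relation[of l r R "u @ u'" "v' @ v"] by simp
next
  case (refl w)
  show ?case by (rule word_cong.refl)
next
  case (sym w w')
  from sym.IH show ?case by (rule word_cong.sym)
next
  case (trans w w' w'')
  from trans.IH show ?case by (rule word_cong.trans)
qed

lemma word_cong_append:
  assumes "(u, u') \<in> word_cong R" "(v, v') \<in> word_cong R"
  shows "(u @ v, u' @ v') \<in> word_cong R"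
proof (rule word_cong.trans)
  show "(u @ v, u' @ v) \<in> word_cong R"
    using word_cong_context[OF assms(1), of "[]" v] by simp
  show "(u' @ v, u' @ v') \<in> word_cong R"
    using word_cong_context[OF assms(2), of u' "[]"] by simp
qed

lemma presented_group_mult:
  "word_cong R `` {u} \<otimes>\<^bsub>presented_group R\<^esub> word_cong R `` {v} = word_cong R `` {u @ v}"
proof -
  have "congruent2 (word_cong R) (word_cong R) (\<lambda>u v. word_cong R `` {u @ v})"
    by (intro congruent2I' equiv_class_eq[OF equiv_word_cong] word_cong_append)
  from UN_equiv_class2[OF equiv_word_cong equiv_word_cong this]
  show ?thesis
    by (simp add: presented_group_def)
qed

lemma word_cong_inverse: "(rev (map (\<lambda>(a, b). (a, \<not> b)) w) @ w, []) \<in> word_cong R"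
proof (induction w)
  case Nil
  then show ?case by (simp add: word_cong.refl)
next
  case (Cons c w)
  obtain a b where c: "c = (a, b)" by (cases c)
  show ?case
    using word_cong.trans[OF word_cong.cancel[of "rev (map (\<lambda>(a, b). (a, \<not> b)) w)" a "\<not> b" w R]
        Cons.IH] c
    by simp
qed

lemma group_presented_group: "group (presented_group R)"
proof (rule groupI)
  let ?G = "presented_group R" and ?c = "\<lambda>w. word_cong R `` {w}"
  have rep: "\<exists>w. A = ?c w" if "A \<in> carrier ?G" for A
    using that by (auto simp: presented_group_def elim: quotientE)
  have cls: "?c w \<in> carrier ?G" for w
    by (simp add: presented_group_def quotientI)
  have one: "\<one>\<^bsub>?G\<^esub> = ?c []"
    by (simp add: presented_group_def)
  show "\<one>\<^bsub>?G\<^esub> \<in> carrier ?G"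
    by (simp add: one cls)
  show "A \<otimes>\<^bsub>?G\<^esub> B \<in> carrier ?G" if "A \<in> carrier ?G" "B \<in> carrier ?G" for A B
    using rep[OF that(1)] rep[OF that(2)] by (auto simp: presented_group_mult cls)
  show "A \<otimes>\<^bsub>?G\<^esub> B \<otimes>\<^bsub>?G\<^esub> C = A \<otimes>\<^bsub>?G\<^esub> (B \<otimes>\<^bsub>?G\<^esub> C)"
    if "A \<in> carrier ?G" "B \<in> carrier ?G" "C \<in> carrier ?G" for A B C
    using rep[OF that(1)] rep[OF that(2)] rep[OF that(3)] by (auto simp: presented_group_mult)
  show "\<one>\<^bsub>?G\<^esub> \<otimes>\<^bsub>?G\<^esub> A = A" if "A \<in> carrier ?G" for A
    using rep[OF that] by (auto simp: one presented_group_mult)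
  show "\<exists>B\<in>carrier ?G. B \<otimes>\<^bsub>?G\<^esub> A = \<one>\<^bsub>?G\<^esub>" if A: "A \<in> carrier ?G" for A
  proof -
    obtain w where w: "A = ?c w" using rep[OF A] by blast
    have "?c (rev (map (\<lambda>(a, b). (a, \<not> b)) w)) \<otimes>\<^bsub>?G\<^esub> A = \<one>\<^bsub>?G\<^esub>"
      unfolding w one presented_group_mult
      by (rule equiv_class_eq[OF equiv_word_cong word_cong_inverse])
    then show ?thesis using cls by blast
  qed
qed

datatype dc_gen = X | Y

definition dc_relations :: "nat \<Rightarrow> (dc_gen word \<times> dc_gen word) set" where
  "dc_relations n =
    {(replicate (2 * n) (X, False), []),
     ([(Y, False), (Y, False)], replicate n (X, False)),
     ([(Y, True), (X, False), (Y, False)], [(X, True)])}"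

definition Dc :: "nat \<Rightarrow> dc_gen word set monoid" where
  "Dc n = presented_group (dc_relations n)"

definition dc_x :: "nat \<Rightarrow> dc_gen word set" where
  "dc_x n = word_cong (dc_relations n) `` {[(X, False)]}"

definition dc_y :: "nat \<Rightarrow> dc_gen word set" where
  "dc_y n = word_cong (dc_relations n) `` {[(Y, False)]}"

end

theory Submission
  imports Defs
begin

text \<open>
  An automorphism is the identity exactly when it fixes the generators \<open>x\<close> and \<open>y\<close>. Iterating
  \<open>x \<mapsto> x\<^sup>r\<close> and \<open>y \<mapsto> y x\<^sup>s\<close> gives a geometric sum in the exponent:
  \<open>\<phi>\<^sup>k\<close> maps \<open>x\<close> to the power of \<open>x\<close> with exponent \<open>r\<^sup>k\<close>, and \<open>y\<close> to \<open>y\<close> times the power of \<open>x\<close>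
  with exponent \<open>s (1 + r + \<dots> + r\<^sup>k\<^sup>-\<^sup>1)\<close> (lemma \<open>auto_power_on_generators\<close>). Hence
  \<open>\<phi>\<^sup>k\<close> is the identity if and only if \<open>ord x\<close> divides both \<open>r\<^sup>k - 1\<close> and that second exponent.

  What remains is that \<open>x\<close> has order exactly \<open>2n\<close> (lemma \<open>ord_dc_x\<close>). The relation \<open>x\<^sup>2\<^sup>n = 1\<close>
  gives only that the order divides \<open>2n\<close>; that the other relations cause no further collapse needs
  a model of the presentation. The model used here is left multiplication on the normal forms
  \<open>x\<^sup>a y\<^sup>e\<close> with \<open>a\<close> modulo \<open>2n\<close> and \<open>e \<in> {0, 1}\<close>: congruent words act equally, and the
  word \<open>x\<^sup>m\<close> shifts \<open>a\<close> by \<open>m\<close>.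
\<close>

section \<open>Presented groups\<close>

lemma word_class_in_carrier: "word_cong R `` {w} \<in> carrier (presented_group R)"
  by (simp add: presented_group_def quotientI)

lemma one_presented_group: "\<one>\<^bsub>presented_group R\<^esub> = word_cong R `` {[]}"
  by (simp add: presented_group_def)

lemma word_class_eq_iff:
  "word_cong R `` {u} = word_cong R `` {v} \<longleftrightarrow> (u, v) \<in> word_cong R"
  using eq_equiv_class_iff[OF equiv_word_cong, of u v R] by simp

lemma word_class_inverse_letter:
  "word_cong R `` {[(a, True)]} = inv\<^bsub>presented_group R\<^esub> (word_cong R `` {[(a, False)]})"
proof -
  interpret group "presented_group R" by (rule group_presented_group)
  have "word_cong R `` {[(a, True)]} \<otimes>\<^bsub>presented_group R\<^esub> word_cong R `` {[(a, False)]}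
      = \<one>\<^bsub>presented_group R\<^esub>"
    using word_cong.cancel[of "[]" a True "[]" R]
    by (simp add: presented_group_mult one_presented_group word_class_eq_iff)
  then show ?thesis
    by (metis inv_equality word_class_in_carrier)
qed

lemma word_class_replicate:
  "word_cong R `` {replicate m c} = (word_cong R `` {[c]}) [^]\<^bsub>presented_group R\<^esub> m"
proof (induction m)
  case 0
  then show ?case by (simp add: one_presented_group)
next
  case (Suc m)
  have "replicate (Suc m) c = replicate m c @ [c]"
    by (simp add: replicate_append_same)
  with Suc show ?case
    by (simp del: replicate_Suc flip: presented_group_mult)
qed

lemma presented_group_hom_eqI:
  assumes "group H"
    and f: "f \<in> hom (presented_group R) H" and g: "g \<in> hom (presented_group R) H"
    and gen: "\<And>a. f (word_cong R `` {[(a, False)]}) = g (word_cong R `` {[(a, False)]})"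
    and A: "A \<in> carrier (presented_group R)"
  shows "f A = g A"
proof -
  let ?c = "\<lambda>w. word_cong R `` {w}"
  interpret f: group_hom "presented_group R" H f
    using assms by (simp add: group_hom_def group_hom_axioms_def group_presented_group)
  interpret g: group_hom "presented_group R" H g
    using assms by (simp add: group_hom_def group_hom_axioms_def group_presented_group)
  have letter: "f (?c [(a, b)]) = g (?c [(a, b)])" for a b
    using gen[of a]
    by (cases b) (simp_all add: word_class_inverse_letter word_class_in_carrier)
  have word: "f (?c w) = g (?c w)" for w
  proof (induction w)
    case Nil
    then show ?case using f.hom_one g.hom_one by (simp add: one_presented_group)
  next
    case (Cons l w)
    obtain a b where l: "l = (a, b)" by (cases l)
    have "?c (l # w) = ?c [(a, b)] \<otimes>\<^bsub>presented_group R\<^esub> ?c w"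
      by (simp add: presented_group_mult l)
    then show ?case
      using Cons letter by (simp add: word_class_in_carrier)
  qed
  obtain w where "A = ?c w"
    using A by (auto simp: presented_group_def elim: quotientE)
  then show ?thesis using word by simp
qed

text \<open>
  Soundness of a model: an action of the letters that satisfies cancellation and the relations
  is constant on congruence classes, so it can prove words different in the group.
  The action takes place on representatives, with \<open>q\<close> the quotient map: this avoids a normalisation at every letter, since the defining equations only have to hold after
  applying \<open>q\<close>.
\<close>

lemma word_cong_act_eq:
  fixes act :: "'a \<times> bool \<Rightarrow> 'b \<Rightarrow> 'b" and q :: "'b \<Rightarrow> 'c"
  assumes compat: "\<And>c p p'. q p = q p' \<Longrightarrow> q (act c p) = q (act c p')"
    and inverse: "\<And>a b p. q (act (a, b) (act (a, \<not> b) p)) = q p"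
    and relators: "\<And>l r p. (l, r) \<in> R \<Longrightarrow> q (foldr act l p) = q (foldr act r p)"
    and "(w, w') \<in> word_cong R"
  shows "q (foldr act w p) = q (foldr act w' p)"
proof -
  have compat_word: "q (foldr act u p) = q (foldr act u p')" if "q p = q p'" for u p p'
    using that by (induction u) (auto intro: compat)
  show ?thesis
    using assms(4)
  proof (induction arbitrary: p rule: word_cong.induct)
    case (cancel u a b v)
    show ?case by (simp, rule compat_word, rule inverse)
  next
    case (relation l r u v)
    then show ?case by (simp, intro compat_word relators)
  qed auto
qed

section \<open>The order of the rotation in the dicyclic group\<close>

text \<open>
  Left multiplication on normal forms, the pair \<open>(a, e)\<close> standing for \<open>x\<^sup>a y\<^sup>e\<close> with
  \<open>True\<close> read as exponent 1. The clauses for \<open>Y\<close> come from \<open>y x\<^sup>a = x\<^sup>-\<^sup>a y\<close> and \<open>y\<^sup>2 = x\<^sup>n\<close>; the inverse letter acts as \<open>x\<^sup>n y\<close>.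
  The exponent \<open>a\<close> is an unreduced integer, to be read modulo \<open>2n\<close>.
\<close>

fun dc_act :: "nat \<Rightarrow> dc_gen \<times> bool \<Rightarrow> int \<times> bool \<Rightarrow> int \<times> bool" where
  "dc_act n (X, b) (a, e) = (if b then a - 1 else a + 1, e)"
| "dc_act n (Y, b) (a, e) = (if b = e then - a else int n - a, \<not> e)"

lemma foldr_dc_act_replicate:
  "foldr (dc_act n) (replicate m (X, False)) (a, e) = (a + int m, e)"
  by (induction m) auto

lemma word_cong_dc_act:
  assumes "(w, w') \<in> word_cong (dc_relations n)"
  shows "map_prod (\<lambda>a. a mod (2 * int n)) id (foldr (dc_act n) w p) =
    map_prod (\<lambda>a. a mod (2 * int n)) id (foldr (dc_act n) w' p)"
  using _ _ _ assms
proof (rule word_cong_act_eq)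
  let ?q = "map_prod (\<lambda>a. a mod (2 * int n)) (id :: bool \<Rightarrow> bool)"
  show "?q (dc_act n c p) = ?q (dc_act n c p')" if eq: "?q p = ?q p'" for c p p'
  proof -
    obtain g b where c: "c = (g, b)" by (cases c)
    obtain a e where p: "p = (a, e)" by (cases p)
    obtain a' where p': "p' = (a', e)" and "a mod (2 * int n) = a' mod (2 * int n)"
      using eq p by (cases p') auto
    then show ?thesis
      by (cases g) (auto simp: c p p' intro: mod_add_cong mod_diff_cong mod_minus_cong)
  qed
  show "?q (dc_act n (g, b) (dc_act n (g, \<not> b) p)) = ?q p" for g b p
    by (cases g; cases p) auto
  show "?q (foldr (dc_act n) l p) = ?q (foldr (dc_act n) r p)"
    if "(l, r) \<in> dc_relations n" for l r p
  proof -
    obtain a e where p: "p = (a, e)" by (cases p)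
    have "(a - int n) mod (2 * int n) = (a + int n) mod (2 * int n)"
      using mod_add_self2[of "a - int n" "2 * int n"] by (simp add: algebra_simps)
    then show ?thesis
      using that
      by (cases e) (auto simp: dc_relations_def p foldr_dc_act_replicate add.commute
          simp del: foldr_replicate)
  qed
qed

lemma group_Dc: "group (Dc n)"
  by (simp add: Dc_def group_presented_group)

lemma dc_x_in_carrier: "dc_x n \<in> carrier (Dc n)"
  by (simp add: Dc_def dc_x_def word_class_in_carrier)

lemma dc_y_in_carrier: "dc_y n \<in> carrier (Dc n)"
  by (simp add: Dc_def dc_y_def word_class_in_carrier)

lemma ord_dc_x: "group.ord (Dc n) (dc_x n) = 2 * n"
proof -
  interpret group "Dc n" by (rule group_Dc)
  have pow: "dc_x n [^]\<^bsub>Dc n\<^esub> m = word_cong (dc_relations n) `` {replicate m (X, False)}" for m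
    by (simp add: Dc_def dc_x_def word_class_replicate)
  have one: "\<one>\<^bsub>Dc n\<^esub> = word_cong (dc_relations n) `` {[]}"
    by (simp add: Dc_def one_presented_group)
  have "dc_x n [^]\<^bsub>Dc n\<^esub> (2 * n) = \<one>\<^bsub>Dc n\<^esub>"
    using word_cong.relation[of "replicate (2 * n) (X, False)" "[]" "dc_relations n" "[]" "[]"]
    by (simp add: pow one word_class_eq_iff dc_relations_def)
  moreover have "2 * n dvd m" if "dc_x n [^]\<^bsub>Dc n\<^esub> m = \<one>\<^bsub>Dc n\<^esub>" for m
  proof -
    have "(replicate m (X, False), []) \<in> word_cong (dc_relations n)"
      using that by (simp add: pow one word_class_eq_iff)
    \<comment> \<open>Both words act on the normal form \<open>(0, False)\<close> of the identity.\<close>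
    from word_cong_dc_act[OF this, of "(0, False)"]
    have "int m mod int (2 * n) = 0"
      by (simp add: foldr_dc_act_replicate del: foldr_replicate)
    then show ?thesis
      by (metis dvd_eq_mod_eq_0 int_dvd_int_iff)
  qed
  ultimately show ?thesis
    by (metis dc_x_in_carrier dvd_antisym pow_eq_id pow_ord_eq_1)
qed

lemma dc_x_int_pow_eq_iff:
  "dc_x n [^]\<^bsub>Dc n\<^esub> (i :: int) = dc_x n [^]\<^bsub>Dc n\<^esub> (j :: int) \<longleftrightarrow> [i = j] (mod (2 * int n))"
  using group.int_pow_eq[OF group_Dc dc_x_in_carrier, of n i j]
  by (simp add: ord_dc_x cong_iff_dvd_diff dvd_diff_commute)

lemma Dc_hom_eqI:
  assumes "group H" "f \<in> hom (Dc n) H" "g \<in> hom (Dc n) H"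
    and "f (dc_x n) = g (dc_x n)" "f (dc_y n) = g (dc_y n)" "A \<in> carrier (Dc n)"
  shows "f A = g A"
proof (rule presented_group_hom_eqI[of H f "dc_relations n" g])
  show "f (word_cong (dc_relations n) `` {[(a, False)]}) =
      g (word_cong (dc_relations n) `` {[(a, False)]})" for a
    using assms(4,5) by (cases a) (simp_all add: dc_x_def dc_y_def)
qed (use assms in \<open>simp_all add: Dc_def\<close>)

section \<open>Powers of an automorphism\<close>

lemma (in group) AutoGroup_pow_in_auto:
  assumes "\<phi> \<in> auto G"
  shows "\<phi> [^]\<^bsub>AutoGroup G\<^esub> (k :: nat) \<in> auto G"
proof -
  interpret A: group "AutoGroup G" by (rule AutoGroup)
  show ?thesis
    using assms A.nat_pow_closed[of \<phi> k] by (simp add: AutoGroup_def)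
qed

lemma (in group) AutoGroup_pow_Suc_apply:
  assumes "\<phi> \<in> auto G" "z \<in> carrier G"
  shows "(\<phi> [^]\<^bsub>AutoGroup G\<^esub> Suc k) z = (\<phi> [^]\<^bsub>AutoGroup G\<^esub> k) (\<phi> z)"
proof -
  have "\<phi> \<in> Bij (carrier G)" "\<phi> [^]\<^bsub>AutoGroup G\<^esub> k \<in> Bij (carrier G)"
    using assms(1) AutoGroup_pow_in_auto[OF assms(1), of k] by (simp_all add: auto_def)
  then show ?thesis
    using assms(2)
    by (simp add: AutoGroup_def BijGroup_def compose_eq)
qed

text \<open>
  The inner factor is peeled off first, \<open>\<phi>\<^sup>k\<^sup>+\<^sup>1 = \<phi>\<^sup>k \<circ> \<phi>\<close>, so that \<open>\<phi>\<^sup>k\<close> is applied to \<open>y x\<^sup>s\<close>: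
  the old exponent of \<open>x\<close> then stays as it is and the next summand \<open>s r\<^sup>k\<close> is
  added to it.
\<close>

lemma (in group) auto_power_on_generators:
  fixes r s :: int
  assumes \<phi>: "\<phi> \<in> auto G" and x: "x \<in> carrier G" and y: "y \<in> carrier G"
    and \<phi>x: "\<phi> x = x [^] r" and \<phi>y: "\<phi> y = y \<otimes> x [^] s"
  shows "(\<phi> [^]\<^bsub>AutoGroup G\<^esub> k) x = x [^] (r ^ k)"
    and "(\<phi> [^]\<^bsub>AutoGroup G\<^esub> k) y = y \<otimes> x [^] (s * (\<Sum>i<k. r ^ i))"
proof -
  let ?p = "\<lambda>k. \<phi> [^]\<^bsub>AutoGroup G\<^esub> (k :: nat)"
  have hom: "group_hom G G (?p k)" for k
    using AutoGroup_pow_in_auto[OF \<phi>, of k]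
    by unfold_locales (simp add: auto_def)
  show px: "?p k x = x [^] (r ^ k)" for k
  proof (induction k)
    case 0
    then show ?case using x by (simp add: AutoGroup_def BijGroup_def int_pow_1)
  next
    case (Suc k)
    have "?p (Suc k) x = ?p k x [^] r"
      using x by (simp only: AutoGroup_pow_Suc_apply[OF \<phi>] \<phi>x group_hom.hom_int_pow[OF hom])
    then show ?case
      using x Suc by (simp only: int_pow_pow power_Suc2)
  qed
  show "?p k y = y \<otimes> x [^] (s * (\<Sum>i<k. r ^ i))"
  proof (induction k)
    case 0
    then show ?case using y by (simp add: AutoGroup_def BijGroup_def)
  next
    case (Suc k)
    have "?p (Suc k) y = ?p k y \<otimes> ?p k x [^] s"
      using x y by (simp only: AutoGroup_pow_Suc_apply[OF \<phi>] \<phi>y group_hom.hom_int_pow[OF hom]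
        group_hom.hom_mult[OF hom] int_pow_closed)
    also have "\<dots> = y \<otimes> x [^] (s * (\<Sum>i<k. r ^ i) + r ^ k * s)"
      using x y by (simp add: Suc px int_pow_pow int_pow_mult m_assoc)
    also have "s * (\<Sum>i<k. r ^ i) + r ^ k * s = s * (\<Sum>i<Suc k. r ^ i)"
      by (simp add: algebra_simps)
    finally show ?case .
  qed
qed

lemma auto_Dc_eq_one_iff:
  assumes "\<psi> \<in> auto (Dc n)"
  shows "\<psi> = \<one>\<^bsub>AutoGroup (Dc n)\<^esub> \<longleftrightarrow> \<psi> (dc_x n) = dc_x n \<and> \<psi> (dc_y n) = dc_y n"
proof
  assume "\<psi> = \<one>\<^bsub>AutoGroup (Dc n)\<^esub>"
  then show "\<psi> (dc_x n) = dc_x n \<and> \<psi> (dc_y n) = dc_y n"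
    by (simp add: AutoGroup_def BijGroup_def dc_x_in_carrier dc_y_in_carrier)
next
  assume fixed: "\<psi> (dc_x n) = dc_x n \<and> \<psi> (dc_y n) = dc_y n"
  have \<psi>: "\<psi> \<in> hom (Dc n) (Dc n)" "\<psi> \<in> extensional (carrier (Dc n))"
    using assms by (simp_all add: auto_def Bij_def)
  have "\<psi> A = A" if "A \<in> carrier (Dc n)" for A
    using Dc_hom_eqI[OF group_Dc \<psi>(1), of "\<lambda>A. A" A] fixed that by (simp add: hom_def)
  then have "\<psi> = (\<lambda>A\<in>carrier (Dc n). A)"
    using \<psi>(2) by (auto intro: extensionalityI)
  then show "\<psi> = \<one>\<^bsub>AutoGroup (Dc n)\<^esub>"
    by (simp add: AutoGroup_def BijGroup_def)
qed

theorem lemma2p7: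
  fixes n k :: nat and r s :: int
    and \<phi> :: "dc_gen word set \<Rightarrow> dc_gen word set"
  assumes "n > 2"
    and "r \<in> Units (residue_ring (2 * int n))"
    and "s \<in> carrier (residue_ring (2 * int n))"
    and "\<phi> \<in> auto (Dc n)"
    and "\<phi> (dc_x n) = dc_x n [^]\<^bsub>Dc n\<^esub> r"
    and "\<phi> (dc_y n) = dc_y n \<otimes>\<^bsub>Dc n\<^esub> (dc_x n [^]\<^bsub>Dc n\<^esub> s)"
    and "k \<ge> 1"
  shows "\<phi> [^]\<^bsub>AutoGroup (Dc n)\<^esub> k = \<one>\<^bsub>AutoGroup (Dc n)\<^esub> \<longleftrightarrow>
    [r ^ k = 1] (mod (2 * int n)) \<and>
    [s * (\<Sum>i<k. r ^ i) = 0] (mod (2 * int n))"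
proof -
  interpret group "Dc n" by (rule group_Dc)
  let ?S = "s * (\<Sum>i<k. r ^ i)"
  note x = dc_x_in_carrier[of n] and y = dc_y_in_carrier[of n]
  have "\<phi> [^]\<^bsub>AutoGroup (Dc n)\<^esub> k = \<one>\<^bsub>AutoGroup (Dc n)\<^esub> \<longleftrightarrow>
      dc_x n [^]\<^bsub>Dc n\<^esub> (r ^ k) = dc_x n \<and> dc_y n \<otimes>\<^bsub>Dc n\<^esub> dc_x n [^]\<^bsub>Dc n\<^esub> ?S = dc_y n"
    using auto_Dc_eq_one_iff[OF AutoGroup_pow_in_auto[OF assms(4)]]
      auto_power_on_generators[OF assms(4) x y assms(5,6)] by simp
  also have "dc_x n [^]\<^bsub>Dc n\<^esub> (r ^ k) = dc_x n \<longleftrightarrow> [r ^ k = 1] (mod (2 * int n))"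
    using dc_x_int_pow_eq_iff[of n "r ^ k" 1] x by (simp add: int_pow_1)
  also have "dc_y n \<otimes>\<^bsub>Dc n\<^esub> dc_x n [^]\<^bsub>Dc n\<^esub> ?S = dc_y n \<longleftrightarrow> [?S = 0] (mod (2 * int n))"
    using dc_x_int_pow_eq_iff[of n ?S 0] x y by (simp add: int_pow_0)
  finally show ?thesis .
qed

end
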